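(* Let $k$ be a field, $V$ a $k$-vector space, and $T \in \mathrm{End}_k(V)$. Then the following are equivalent. (1) $T$ is triangularizable. (2) For every finite-dimensional subspace $W$ of $V$ there is a polynomial $p(x) \in k[x]\setminus k$ that factors into linear terms in $k[x]$, such that $p(T)$ annihilates $W$. (3) There exists a well-ordered (by inclusion) set of $T$-invariant subspaces of $V$, which is maximal as a well-ordered set of subspaces of $V$. (4) $V = \bigoplus_{a \in k} \bigcup_{i=1}^\infty \ker((T-aI)^i)$, where $I \in \mathrm{End}_k(V)$ is the identity transformation. (5) There is a partially ordered basis $(\mathcal{B}, \preceq)$ for $V$ such that $T$ is triangular with respect to $(\mathcal{B}, \preceq)$ and $\{u \in \mathcal{B} \mid u \preceq v\}$ is finite for all $v\in \mathcal{B}$. Moreover, if $k$ is algebraically closed, then these are also equivalent to the following. (6) Every finite-dimensional subspace of $V$ is contained in a finite-dimensional $T$-invariant subspace of $V$. (7) $V$ is locally artinian, when viewed as a $k[x]$-module, where $x$ acts on $V$ as $T$.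
   Context: $V$ has arbitrary dimension. $\mathrm{End}_k(V)$ is the $k$-algebra of all linear transformations of $V$, and $\langle X\rangle$ is the subspace generated by a subset $X$ of $V$. Given a basis $\mathcal{B}$ for $V$ and a partial order $\leq$ on $\mathcal{B}$, $T \in \mathrm{End}_k(V)$ is triangular with respect to $(\mathcal{B}, \leq)$ if $T(v) \in \langle \{u \in \mathcal{B} \mid u \leq v\} \rangle$ for all $v \in \mathcal{B}$. $T$ is triangularizable if it is triangular with respect to some well-ordered basis for $V$ (i.e. for some basis $\mathcal{B}$ and some well order $\leq$ on $\mathcal{B}$). A subspace $W$ is $T$-invariant if $T(W) \subseteq W$. In (3), sets of subspaces are ordered by inclusion, and maximality means that the set (which consists of $T$-invariant subspaces) is not properly contained in any set of (arbitrary) subspaces of $V$ that is well-ordered by inclusion. For a commutative ring $R$, an $R$-module $M$ is locally artinian if every finitely generated $R$-submodule of $M$ is artinian. *)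

theory Defs
  imports Complex_Main "HOL-Computational_Algebra.Polynomial"
begin

(* Everywhere below, scale is the scalar multiplication of a module or vector
   space whose carrier is the whole type; the definitions are only meaningful
   under the locale predicate module scale or vector_space scale. *)

definition is_direct_sum ::
    "('r::comm_ring_1 \<Rightarrow> 'm::ab_group_add \<Rightarrow> 'm) \<Rightarrow> ('i \<Rightarrow> 'm set) \<Rightarrow> bool" where
  "is_direct_sum scale U \<longleftrightarrow> (\<forall>i. module.subspace scale (U i)) \<and>
    (\<forall>v. \<exists>!f. (\<forall>i. f i \<in> U i) \<and> finite {i. f i \<noteq> 0} \<and> v = (\<Sum>i | f i \<noteq> 0. f i))"

definition artinian_submodule ::
    "('r::comm_ring_1 \<Rightarrow> 'm::ab_group_add \<Rightarrow> 'm) \<Rightarrow> 'm set \<Rightarrow> bool" where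
  "artinian_submodule scale M \<longleftrightarrow> module.subspace scale M \<and>
    (\<forall>N :: nat \<Rightarrow> 'm set. (\<forall>n. module.subspace scale (N n) \<and> N n \<subseteq> M) \<and> decseq N
      \<longrightarrow> (\<exists>m. \<forall>n\<ge>m. N n = N m))"

definition locally_artinian ::
    "('r::comm_ring_1 \<Rightarrow> 'm::ab_group_add \<Rightarrow> 'm) \<Rightarrow> bool" where
  "locally_artinian scale \<longleftrightarrow>
    (\<forall>S. finite S \<longrightarrow> artinian_submodule scale (module.span scale S))"

definition splits_into_linear_factors :: "'k::field poly \<Rightarrow> bool" where
  "splits_into_linear_factors p \<longleftrightarrow> (\<exists>qs. (\<forall>q\<in>set qs. degree q = 1) \<and> p = prod_list qs)"

definition well_ordered_by_inclusion :: "'v set set \<Rightarrow> bool" where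
  "well_ordered_by_inclusion C \<longleftrightarrow> well_order_on C {(A, B). A \<in> C \<and> B \<in> C \<and> A \<subseteq> B}"

definition is_basis :: "('k::field \<Rightarrow> 'v::ab_group_add \<Rightarrow> 'v) \<Rightarrow> 'v set \<Rightarrow> bool" where
  "is_basis scale B \<longleftrightarrow> \<not> module.dependent scale B \<and> module.span scale B = UNIV"

definition finite_dim_subspace ::
    "('k::field \<Rightarrow> 'v::ab_group_add \<Rightarrow> 'v) \<Rightarrow> 'v set \<Rightarrow> bool" where
  "finite_dim_subspace scale W \<longleftrightarrow>
    module.subspace scale W \<and>
    (\<exists>B. finite B \<and> \<not> module.dependent scale B \<and> module.span scale B = W)"

(* (u, v) \<in> r stands for u \<le> v *)
definition triangular_wrt ::
    "('k::field \<Rightarrow> 'v::ab_group_add \<Rightarrow> 'v) \<Rightarrow> 'v set \<Rightarrow> 'v rel \<Rightarrow> ('v \<Rightarrow> 'v) \<Rightarrow> bool" where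
  "triangular_wrt scale B r T \<longleftrightarrow>
    (\<forall>v\<in>B. T v \<in> module.span scale {u \<in> B. (u, v) \<in> r})"

definition triangularizable ::
    "('k::field \<Rightarrow> 'v::ab_group_add \<Rightarrow> 'v) \<Rightarrow> ('v \<Rightarrow> 'v) \<Rightarrow> bool" where
  "triangularizable scale T \<longleftrightarrow>
    (\<exists>B r. is_basis scale B \<and> well_order_on B r \<and> triangular_wrt scale B r T)"

definition invariant_subspace ::
    "('k::field \<Rightarrow> 'v::ab_group_add \<Rightarrow> 'v) \<Rightarrow> ('v \<Rightarrow> 'v) \<Rightarrow> 'v set \<Rightarrow> bool" where
  "invariant_subspace scale T W \<longleftrightarrow> module.subspace scale W \<and> T ` W \<subseteq> W"

(* poly_act scale T p is the endomorphism p(T). As a function of p and v,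
   poly_act scale T is the scalar multiplication of the k[x]-module in which
   x acts as T, see module_poly_act and poly_act_x. *)
definition poly_act ::
    "('k::field \<Rightarrow> 'v::ab_group_add \<Rightarrow> 'v) \<Rightarrow> ('v \<Rightarrow> 'v) \<Rightarrow> 'k poly \<Rightarrow> 'v \<Rightarrow> 'v" where
  "poly_act scale T p v = (\<Sum>i\<le>degree p. scale (coeff p i) ((T ^^ i) v))"

definition generalized_eigenspace ::
    "('k::field \<Rightarrow> 'v::ab_group_add \<Rightarrow> 'v) \<Rightarrow> ('v \<Rightarrow> 'v) \<Rightarrow> 'k \<Rightarrow> 'v set" where
  "generalized_eigenspace scale T a =
    (\<Union>i\<in>{1..}. {v. ((\<lambda>w. T w - scale a w) ^^ i) v = 0})"

context
  fixes scale :: "'k::field \<Rightarrow> 'v::ab_group_add \<Rightarrow> 'v" and T :: "'v \<Rightarrow> 'v"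
  assumes lin: "Vector_Spaces.linear scale scale T"
begin

interpretation T: Vector_Spaces.linear scale scale T by (fact lin)

lemma poly_act_upper:
  assumes "degree p \<le> n"
  shows "poly_act scale T p v = (\<Sum>i\<le>n. scale (coeff p i) ((T ^^ i) v))"
  unfolding poly_act_def
  by (rule sum.mono_neutral_left) (use assms in \<open>auto simp: coeff_eq_0\<close>)

lemma poly_act_pCons:
  "poly_act scale T (pCons a p) v = scale a v + T (poly_act scale T p v)"
proof -
  have "poly_act scale T (pCons a p) v
      = (\<Sum>i\<le>Suc (degree p). scale (coeff (pCons a p) i) ((T ^^ i) v))"
    by (rule poly_act_upper) (simp add: degree_pCons_le)
  also have "\<dots> = scale a v + (\<Sum>i\<le>degree p. scale (coeff p i) (T ((T ^^ i) v)))"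
    by (subst sum.atMost_Suc_shift) simp
  also have "(\<Sum>i\<le>degree p. scale (coeff p i) (T ((T ^^ i) v))) = T (poly_act scale T p v)"
    by (simp add: poly_act_def T.sum T.scale)
  finally show ?thesis .
qed

lemma poly_act_x: "poly_act scale T [:0, 1:] v = T v"
  by (simp add: poly_act_def)

lemma poly_act_add:
  "poly_act scale T (p + q) v = poly_act scale T p v + poly_act scale T q v"
proof -
  let ?n = "max (degree p) (degree q)"
  have "degree (p + q) \<le> ?n" by (rule degree_add_le_max)
  then show ?thesis
    by (simp add: poly_act_upper[of _ ?n] T.vs1.scale_left_distrib sum.distrib)
qed

lemma poly_act_smult: "poly_act scale T (smult c p) v = scale c (poly_act scale T p v)"
  by (subst poly_act_upper[OF degree_smult_le])
    (simp add: poly_act_def T.vs1.scale_sum_right)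

lemma module_poly_act: "module (poly_act scale T)"
proof
  fix p q :: "'k poly" and v w :: 'v
  have pow: "(T ^^ i) (v + w) = (T ^^ i) v + (T ^^ i) w" for i
    by (induction i) (auto simp: T.add)
  show "poly_act scale T p (v + w) = poly_act scale T p v + poly_act scale T p w"
    by (simp add: poly_act_def pow T.vs1.scale_right_distrib sum.distrib)
  show "poly_act scale T (p + q) v = poly_act scale T p v + poly_act scale T q v"
    by (rule poly_act_add)
  show "poly_act scale T p (poly_act scale T q v) = poly_act scale T (p * q) v"
  proof (induction p)
    case 0
    then show ?case by (simp add: poly_act_def)
  next
    case (pCons a p)
    then show ?case
      by (simp add: poly_act_pCons poly_act_add poly_act_smult)
  qed
  show "poly_act scale T 1 v = v"
    by (simp add: poly_act_def)
qed

end

end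

theory Submission
  imports Defs
begin

text \<open>
  All conditions are compared with the single statement that the span \<open>S\<close> of the generalized
  eigenspaces is the whole space. The tool for reaching it is that
  \<open>T v - a v \<in> S\<close> implies \<open>v \<in> S\<close>, because \<open>T - a I\<close> maps every generalized
  eigenspace for \<open>b \<noteq> a\<close> onto itself; a well-founded induction along a basis, a chain of
  subspaces or the linear factors of a polynomial then shows that \<open>S\<close> is everything.
  Conversely, if \<open>S\<close> is everything, extending bases along the filtration by the subspaces
  spanned by all \<open>ker (T - a I)^n\<close> gives a basis with a height function such that
  \<open>T v - a v\<close> only involves basis vectors lower than \<open>v\<close>.
\<close>

section \<open>Chains well-ordered by inclusion, finite initial segments, descending
  subspaces\<close>

lemma well_ordered_by_inclusion_iff:
  "well_ordered_by_inclusion C \<longleftrightarrow>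
    (\<forall>A\<in>C. \<forall>B\<in>C. A \<subseteq> B \<or> B \<subseteq> A) \<and> wf {(A, B). A \<in> C \<and> B \<in> C \<and> A \<subset> B}"
proof -
  have "{(A, B). A \<in> C \<and> B \<in> C \<and> A \<subseteq> B} - Id = {(A, B). A \<in> C \<and> B \<in> C \<and> A \<subset> B}"
    by auto
  moreover have "linear_order_on C {(A, B). A \<in> C \<and> B \<in> C \<and> A \<subseteq> B} \<longleftrightarrow>
      (\<forall>A\<in>C. \<forall>B\<in>C. A \<subseteq> B \<or> B \<subseteq> A)"
    unfolding linear_order_on_def partial_order_on_def preorder_on_def
    by (auto intro!: refl_onI transI antisymI simp: total_on_def)
  ultimately show ?thesis
    by (simp only: well_ordered_by_inclusion_def well_order_on_def)
qed

text \<open>This is how maximality of a chain gets used: a subspace comparable with every member can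
  be added, so it must already be a member. A minimal element of \<open>Q\<close> is the least
  member \<open>m\<close> of \<open>Q \<inter> C\<close>, unless \<open>U\<close> lies in
  \<open>Q\<close> strictly below \<open>m\<close>.\<close>

lemma well_ordered_by_inclusion_insert:
  assumes C: "well_ordered_by_inclusion C" and U: "\<And>A. A \<in> C \<Longrightarrow> A \<subseteq> U \<or> U \<subseteq> A"
  shows "well_ordered_by_inclusion (insert U C)"
proof -
  have wf: "wf {(A, B). A \<in> C \<and> B \<in> C \<and> A \<subset> B}"
    and chain: "\<forall>A\<in>C. \<forall>B\<in>C. A \<subseteq> B \<or> B \<subseteq> A"
    using C by (auto simp: well_ordered_by_inclusion_iff)
  have "\<exists>z\<in>Q. \<forall>y. y \<in> insert U C \<and> z \<in> insert U C \<and> y \<subset> z \<longrightarrow> y \<notin> Q" if "x \<in> Q" for x Q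
  proof (cases "Q \<inter> C = {}")
    case True
    then show ?thesis using that by blast
  next
    case False
    obtain m where "m \<in> Q \<inter> C"
      and "\<And>y. (y, m) \<in> {(A, B). A \<in> C \<and> B \<in> C \<and> A \<subset> B} \<Longrightarrow> y \<notin> Q \<inter> C"
      by (rule wfE_min'[OF wf False]) (rule that)
    then have m: "m \<in> Q" "m \<in> C" "\<And>y. y \<in> C \<Longrightarrow> y \<subset> m \<Longrightarrow> y \<notin> Q" by auto
    show ?thesis
    proof (cases "U \<in> Q \<and> U \<subset> m")
      case True
      then show ?thesis using m by (intro bexI[of _ U]) auto
    next
      case False
      then show ?thesis using m by (intro bexI[of _ m]) auto
    qed
  qed
  then have "wf {(A, B). A \<in> insert U C \<and> B \<in> insert U C \<and> A \<subset> B}"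
    unfolding wf_eq_minimal by simp
  then show ?thesis
    using chain U by (auto simp: well_ordered_by_inclusion_iff)
qed

text \<open>The size of the initial segment is a strictly increasing natural-number rank. Strictness
  is witnessed by \<open>v\<close>, which lies in its own segment but, by antisymmetry, not in that
  of a smaller \<open>u\<close>.\<close>

lemma wf_strict_part_of_finite_initial_segments:
  assumes po: "partial_order_on B r" and fin: "\<And>v. v \<in> B \<Longrightarrow> finite {u \<in> B. (u, v) \<in> r}"
  shows "wf (r - Id)"
proof -
  have r: "r \<subseteq> B \<times> B" "trans r" "antisym r" "refl_on B r"
    using po by (auto simp: order_on_defs)
  have "r - Id \<subseteq> measure (\<lambda>v. card {u \<in> B. (u, v) \<in> r})"
  proof (rule subrelI)
    fix u v assume "(u, v) \<in> r - Id"
    then have uv: "(u, v) \<in> r" "u \<noteq> v" by auto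
    have "v \<in> {w \<in> B. (w, v) \<in> r} - {w \<in> B. (w, u) \<in> r}"
      using uv r by (auto simp: refl_on_def dest: antisymD)
    moreover have "{w \<in> B. (w, u) \<in> r} \<subseteq> {w \<in> B. (w, v) \<in> r}"
      using uv r by (auto dest: transD)
    ultimately have "{w \<in> B. (w, u) \<in> r} \<subset> {w \<in> B. (w, v) \<in> r}"
      by blast
    then show "(u, v) \<in> measure (\<lambda>v. card {u \<in> B. (u, v) \<in> r})"
      using fin uv r by (auto intro!: psubset_card_mono)
  qed
  then show ?thesis
    by (rule wf_subset[OF wf_measure])
qed

text \<open>The index \<open>m\<close> is chosen to minimize the dimension. Past it, a basis of
  \<open>N n\<close> extends to one of \<open>N m\<close> that cannot have more elements, so the two
  bases coincide.\<close>

lemma (in vector_space) decreasing_subspaces_stabilize: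
  assumes "finite S" and sub: "\<And>n. subspace (N n)" "\<And>n. N n \<subseteq> span S" and dec: "decseq N"
  shows "\<exists>m. \<forall>n\<ge>m. N n = N m"
proof -
  define m where "m = (ARG_MIN (\<lambda>n. dim (N n)) n. True)"
  have min: "dim (N m) \<le> dim (N n)" for n
    unfolding m_def by (rule arg_min_nat_le) simp
  have "N n = N m" if "n \<ge> m" for n
  proof -
    have nm: "N n \<subseteq> N m" using dec that by (auto simp: decseq_def)
    obtain A where A: "A \<subseteq> N n" "independent A" "N n \<subseteq> span A" "card A = dim (N n)"
      using basis_exists by blast
    obtain A' where A': "A \<subseteq> A'" "A' \<subseteq> N m" "independent A'" "N m \<subseteq> span A'"
      using maximal_independent_subset_extend[of A "N m"] A nm by blast
    have "finite A'"
      using independent_span_bound[OF \<open>finite S\<close> A'(3)] A'(2) sub(2) by blast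
    moreover have "card A' = dim (N m)"
      using A' by (metis basis_card_eq_dim)
    ultimately have "A = A'"
      using min[of n] A(4) A'(1) by (metis card_seteq)
    then show ?thesis
      using A A' nm span_minimal[OF A(1) sub(1)] by blast
  qed
  then show ?thesis by blast
qed

section \<open>One endomorphism: its \<open>k[x]\<close>-module structure and the operators
  \<open>T - a I\<close>\<close>

locale endomorphism = vector_space scale + T: Vector_Spaces.linear scale scale T
  for scale :: "'k::field \<Rightarrow> 'v::ab_group_add \<Rightarrow> 'v" (infixr "*s" 75) and T :: "'v \<Rightarrow> 'v"
begin

text \<open>From here on \<open>PM.span\<close> and \<open>PM.subspace\<close> concern
  \<open>k[x]\<close>-submodules, while the unprefixed notions concern
  \<open>k\<close>-subspaces.\<close>

sublocale PM: module "poly_act scale T"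
  by (rule module_poly_act) (rule T.linear_axioms)

lemmas act_pCons = poly_act_pCons[OF T.linear_axioms]

lemma act_0: "poly_act scale T 0 v = 0"
  by (simp add: poly_act_def)

lemma act_const: "poly_act scale T [:c:] v = c *s v"
  by (simp add: act_pCons act_0 T.zero)

definition shift :: "'k \<Rightarrow> 'v \<Rightarrow> 'v" where
  "shift a v = T v - a *s v"

lemma T_eq_shift: "T v = shift a v + a *s v"
  by (simp add: shift_def)

lemma shift_add: "shift a (u + v) = shift a u + shift a v"
  by (simp add: shift_def T.add scale_right_distrib)

lemma shift_scale: "shift a (c *s v) = c *s shift a v"
  by (simp add: shift_def T.scale scale_right_diff_distrib mult.commute)

lemma shift_zero [simp]: "shift a 0 = 0"
  by (simp add: shift_def T.zero)

lemma shift_diff: "shift a (u - v) = shift a u - shift a v"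
  by (simp add: shift_def T.diff scale_right_diff_distrib)

lemma shift_sum: "shift a (sum f A) = (\<Sum>i\<in>A. shift a (f i))"
  by (induction A rule: infinite_finite_induct) (auto simp: shift_add)

lemma shift_commute: "shift a (shift b v) = shift b (shift a v)"
  by (simp add: shift_def T.diff T.scale scale_right_diff_distrib mult.commute algebra_simps)

text \<open>Two shifts with different parameters differ by an invertible scalar. Both the
  injectivity and the surjectivity of \<open>shift a\<close> on \<open>G b\<close> rest on
  this.\<close>

lemma shift_diff_shift: "shift a v - shift b v = (b - a) *s v"
  by (simp add: shift_def scale_left_diff_distrib)

lemma shift_pow_add: "(shift a ^^ n) (u + v) = (shift a ^^ n) u + (shift a ^^ n) v"
  by (induction n) (auto simp: shift_add)

lemma shift_pow_scale: "(shift a ^^ n) (c *s v) = c *s (shift a ^^ n) v"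
  by (induction n) (auto simp: shift_scale)

lemma shift_pow_zero [simp]: "(shift a ^^ n) 0 = 0"
  by (induction n) auto

lemma shift_pow_sum: "(shift a ^^ n) (sum f A) = (\<Sum>i\<in>A. (shift a ^^ n) (f i))"
  by (induction n) (auto simp: shift_sum)

lemma shift_pow_shift: "(shift b ^^ n) (shift a v) = shift a ((shift b ^^ n) v)"
  by (induction n) (auto simp: shift_commute)

lemma shift_pow_commute: "(shift b ^^ n) ((shift a ^^ m) v) = (shift a ^^ m) ((shift b ^^ n) v)"
  by (induction m) (auto simp: shift_pow_shift)

lemma shift_pow_mono:
  assumes "(shift a ^^ m) v = 0" "m \<le> n"
  shows "(shift a ^^ n) v = 0"
proof -
  have "(shift a ^^ n) v = (shift a ^^ (n - m)) ((shift a ^^ m) v)"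
    using assms(2) by (simp flip: funpow_add comp_apply[of "shift a ^^ (n - m)"])
  then show ?thesis using assms(1) by simp
qed

section \<open>Generalized eigenspaces and the action of the shifts on them\<close>

abbreviation G :: "'k \<Rightarrow> 'v set" where
  "G \<equiv> generalized_eigenspace scale T"

lemma G_iff: "v \<in> G a \<longleftrightarrow> (\<exists>n. (shift a ^^ n) v = 0)"
proof
  assume "v \<in> G a"
  then show "\<exists>n. (shift a ^^ n) v = 0"
    by (auto simp: generalized_eigenspace_def shift_def[abs_def])
next
  assume "\<exists>n. (shift a ^^ n) v = 0"
  then obtain n where "(shift a ^^ n) v = 0" by blast
  then have "(shift a ^^ Suc n) v = 0" by simp
  then show "v \<in> G a"
    unfolding generalized_eigenspace_def shift_def[abs_def]
    by (intro UN_I[of "Suc n"]) auto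
qed

lemma subspace_G: "subspace (G a)"
proof (rule subspaceI)
  show "0 \<in> G a" by (auto simp: G_iff)
  fix u v assume "u \<in> G a" "v \<in> G a"
  then obtain m n where "(shift a ^^ m) u = 0" "(shift a ^^ n) v = 0" by (auto simp: G_iff)
  then have "(shift a ^^ max m n) (u + v) = 0"
    by (metis shift_pow_add shift_pow_mono add_0 max.cobounded1 max.cobounded2)
  then show "u + v \<in> G a" by (auto simp: G_iff)
next
  fix c v assume "v \<in> G a"
  then show "c *s v \<in> G a" by (auto simp: G_iff shift_pow_scale)
qed

text \<open>Induction on the power of \<open>shift b\<close> killing \<open>v\<close>: the vector
  \<open>shift b v\<close> satisfies the same assumptions with a smaller exponent, so it vanishes.
  Then both shifts kill \<open>v\<close>, hence so does the scalar \<open>b - a\<close>.\<close>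

lemma shift_injective_on_G:
  assumes "a \<noteq> b" "v \<in> G b" "shift a v = 0"
  shows "v = 0"
proof -
  obtain n where "(shift b ^^ n) v = 0" using assms(2) by (auto simp: G_iff)
  then show ?thesis using assms(3)
  proof (induction n arbitrary: v)
    case (Suc n)
    have "(shift b ^^ n) (shift b v) = 0" using Suc.prems(1) by (simp add: funpow_swap1)
    moreover have "shift a (shift b v) = 0" by (subst shift_commute) (simp add: Suc.prems(2))
    ultimately have "shift b v = 0" by (rule Suc.IH)
    then show ?case
      using shift_diff_shift[of b v a] Suc.prems assms(1) by simp
  qed auto
qed

lemma shift_pow_injective_on_G:
  assumes "a \<noteq> b" "v \<in> G b" "(shift a ^^ n) v = 0"
  shows "v = 0"
  using assms(2,3)
proof (induction n arbitrary: v)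
  case (Suc n)
  then have "shift a v \<in> G b" by (auto simp: G_iff shift_pow_shift) (metis shift_zero)
  then have "shift a v = 0" using Suc by (auto simp: funpow_swap1)
  then show ?case using shift_injective_on_G Suc.prems assms(1) by blast
qed auto

lemma shift_surjective_on_G:
  assumes "a \<noteq> b" "v \<in> G b"
  shows "\<exists>u\<in>G b. shift a u = v"
proof -
  obtain n where "(shift b ^^ n) v = 0" using assms(2) by (auto simp: G_iff)
  then show ?thesis
  proof (induction n arbitrary: v)
    case 0
    then show ?case by (intro bexI[of _ 0]) (auto simp: subspace_0[OF subspace_G])
  next
    case (Suc n)
    have v: "v \<in> G b" using Suc.prems unfolding G_iff by blast
    obtain u where u: "u \<in> G b" "shift a u = shift b v"
      using Suc by (auto simp: funpow_swap1)
    \<comment> \<open>Since \<open>shift a u = shift b v\<close>, the image of \<open>v - u\<close>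
      is \<open>shift a v - shift b v\<close>, which is \<open>(b - a) *s v\<close>. Dividing by
      \<open>b - a\<close> gives a preimage of \<open>v\<close>.\<close>
    let ?u = "(1 / (b - a)) *s (v - u)"
    have "shift a ?u = (1 / (b - a)) *s ((b - a) *s v)"
      by (simp only: shift_scale shift_diff u shift_diff_shift)
    also have "\<dots> = v" using assms(1) by simp
    finally show ?case
      using u v by (intro bexI[of _ ?u]) (auto intro!: subspace_scale subspace_diff subspace_G)
  qed
qed

section \<open>The span of the generalized eigenspaces and its directness\<close>

definition S :: "'v set" where
  "S = span (\<Union>a. G a)"

lemma subspace_S: "subspace S"
  by (simp add: S_def)

lemma G_subset_S: "G a \<subseteq> S"
  unfolding S_def by (meson UNIV_I UN_upper order_trans span_superset)

text \<open>Surjectivity on the other eigenspaces shows that \<open>S\<close> is the image of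
  \<open>S\<close> under \<open>shift a\<close> up to elements of \<open>G a\<close>. Correcting
  \<open>v\<close> by a suitable \<open>u\<close> in \<open>S\<close> therefore puts the image of
  \<open>v - u\<close> in \<open>G a\<close>, and then \<open>v - u\<close> itself is killed by one
  power more.\<close>

lemma S_shift:
  assumes "shift a v \<in> S"
  shows "v \<in> S"
proof -
  have "\<exists>u\<in>S. w - shift a u \<in> G a" if "w \<in> S" for w
    using that[unfolded S_def]
  proof (induction w rule: span_induct_alt)
    case base
    show ?case by (intro bexI[of _ 0]) (auto simp: subspace_0 subspace_G subspace_S)
  next
    case (step c x y)
    then obtain b u where b: "x \<in> G b" and u: "u \<in> S" "y - shift a u \<in> G a" by blast
    show ?case
    proof (cases "a = b")
      case True
      have "c *s x + (y - shift a u) \<in> G a"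
        using b u True by (intro subspace_add subspace_scale subspace_G) auto
      then show ?thesis using u by (intro bexI[of _ u]) (auto simp: algebra_simps)
    next
      case False
      then obtain z where z: "z \<in> G b" "shift a z = x"
        using shift_surjective_on_G b by blast
      have "c *s z + u \<in> S"
        using z u G_subset_S by (intro subspace_add subspace_scale subspace_S) auto
      then show ?thesis
        using u z by (intro bexI[of _ "c *s z + u"]) (auto simp: shift_add shift_scale)
    qed
  qed
  then obtain u where u: "u \<in> S" "shift a v - shift a u \<in> G a" using assms by blast
  then obtain n where "(shift a ^^ n) (shift a (v - u)) = 0" by (auto simp: G_iff shift_diff)
  then have "(shift a ^^ Suc n) (v - u) = 0" by (simp add: funpow_swap1)
  then have "v - u \<in> G a" unfolding G_iff by blast
  then have "v - u \<in> S" using G_subset_S by blast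
  then show ?thesis using subspace_add[OF subspace_S _ u(1)] by fastforce
qed

text \<open>A power of \<open>shift a\<close> that kills \<open>f a\<close> turns the relation into
  a shorter one, whose terms vanish by induction. This power is injective on every other
  \<open>G b\<close>, so the original terms vanish as well.\<close>

lemma G_independent:
  assumes "finite A" "\<And>a. a \<in> A \<Longrightarrow> f a \<in> G a" "sum f A = 0"
  shows "\<forall>a\<in>A. f a = 0"
  using assms
proof (induction A arbitrary: f)
  case (insert a A)
  obtain n where n: "(shift a ^^ n) (f a) = 0" using insert.prems(1)[of a] by (auto simp: G_iff)
  have "\<forall>b\<in>A. (shift a ^^ n) (f b) = 0"
  proof (rule insert.IH)
    show "(shift a ^^ n) (f b) \<in> G b" if "b \<in> A" for b
      using insert.prems(1)[of b] that unfolding G_iff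
      by (metis insertCI shift_pow_commute shift_pow_zero)
    have "(shift a ^^ n) (sum f (insert a A)) = 0" using insert.prems by simp
    then show "(\<Sum>b\<in>A. (shift a ^^ n) (f b)) = 0"
      using insert.hyps n by (simp add: shift_pow_sum shift_pow_add)
  qed
  then have "\<forall>b\<in>A. f b = 0"
    using shift_pow_injective_on_G insert.prems(1) insert.hyps(2) by (metis insertCI)
  then show ?case using insert by simp
qed auto

text \<open>Spanning amounts to existence of decompositions, and uniqueness follows from
  \<open>G_independent\<close> applied to the difference of two of them.\<close>

lemma direct_sum_iff: "is_direct_sum scale G \<longleftrightarrow> S = UNIV"
proof
  assume ds: "is_direct_sum scale G"
  have "v \<in> S" for v
  proof -
    have "\<exists>!f. (\<forall>i. f i \<in> G i) \<and> finite {i. f i \<noteq> 0} \<and> v = (\<Sum>i | f i \<noteq> 0. f i)"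
      using ds unfolding is_direct_sum_def by (elim conjE allE)
    then obtain f where f: "\<forall>i. f i \<in> G i" "v = (\<Sum>i | f i \<noteq> 0. f i)"
      by (elim ex1E conjE) (rule that)
    show ?thesis
      unfolding f(2) using f(1) G_subset_S by (intro subspace_sum subspace_S) auto
  qed
  then show "S = UNIV" by auto
next
  assume S: "S = UNIV"
  have ex: "\<exists>f. (\<forall>i. f i \<in> G i) \<and> finite {i. f i \<noteq> 0} \<and> v = (\<Sum>i | f i \<noteq> 0. f i)" for v
  proof -
    have "v \<in> span (\<Union>a. G a)" using S by (auto simp: S_def)
    then show ?thesis
    proof (induction v rule: span_induct_alt)
      case base
      show ?case by (intro exI[of _ "\<lambda>_. 0"]) (auto simp: subspace_0 subspace_G)
    next
      case (step c x y)
      then obtain a f where a: "x \<in> G a" and f: "\<forall>i. f i \<in> G i" "finite {i. f i \<noteq> 0}"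
        "y = (\<Sum>i | f i \<noteq> 0. f i)" by blast
      \<comment> \<open>The new summand is absorbed into the component at \<open>a\<close>. Either
        \<open>f a\<close> or the new component may be zero, so sums are compared over
        \<open>?A\<close>, which contains both supports.\<close>
      let ?g = "f(a := c *s x + f a)" and ?A = "insert a {i. f i \<noteq> 0}"
      have fin: "finite ?A" using f by simp
      have "(\<Sum>i | ?g i \<noteq> 0. ?g i) = sum ?g ?A"
        by (rule sum.mono_neutral_left) (use fin in auto)
      also have "\<dots> = ?g a + sum ?g (?A - {a})" by (rule sum.remove[OF fin]) simp
      also have "sum ?g (?A - {a}) = sum f (?A - {a})" by (rule sum.cong) auto
      also have "?g a + sum f (?A - {a}) = c *s x + sum f ?A"
        using fin by (simp add: sum.remove[of ?A a f])
      also have "sum f ?A = y" unfolding f(3) using fin by (intro sum.mono_neutral_right) auto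
      finally have "c *s x + y = (\<Sum>i | ?g i \<noteq> 0. ?g i)" ..
      moreover have "finite {i. ?g i \<noteq> 0}" by (rule finite_subset[OF _ fin]) auto
      moreover have "\<forall>i. ?g i \<in> G i"
        using f(1) a by (auto intro!: subspace_add subspace_scale subspace_G)
      ultimately show ?case by (intro exI[of _ ?g]) auto
    qed
  qed
  have uniq: "f = g" if f: "\<forall>i. f i \<in> G i" "finite {i. f i \<noteq> 0}"
    and g: "\<forall>i. g i \<in> G i" "finite {i. g i \<noteq> 0}"
    and eq: "(\<Sum>i | f i \<noteq> 0. f i) = (\<Sum>i | g i \<noteq> 0. g i)" for f g
  proof -
    let ?A = "{i. f i \<noteq> 0} \<union> {i. g i \<noteq> 0}"
    have fin: "finite ?A" using f g by simp
    have "(\<Sum>i | f i \<noteq> 0. f i) = sum f ?A" "(\<Sum>i | g i \<noteq> 0. g i) = sum g ?A"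
      by (rule sum.mono_neutral_left; use fin in auto)+
    then have "(\<Sum>i\<in>?A. f i - g i) = 0" using eq by (simp add: sum_subtractf)
    moreover have "f i - g i \<in> G i" for i
      using f g by (intro subspace_diff subspace_G) auto
    ultimately have zero: "\<forall>i\<in>?A. f i - g i = 0" by (intro G_independent fin)
    show ?thesis
    proof
      fix i
      show "f i = g i"
      proof (cases "i \<in> ?A")
        case True
        then have "f i - g i = 0" by (rule bspec[OF zero])
        then show ?thesis by simp
      qed simp
    qed
  qed
  show "is_direct_sum scale G"
    unfolding is_direct_sum_def
  proof (intro conjI allI subspace_G)
    fix v
    show "\<exists>!f. (\<forall>i. f i \<in> G i) \<and> finite {i. f i \<noteq> 0} \<and> v = (\<Sum>i | f i \<noteq> 0. f i)"
    proof (rule ex_ex1I[OF ex])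
      fix f g
      assume f: "(\<forall>i. f i \<in> G i) \<and> finite {i. f i \<noteq> 0} \<and> v = (\<Sum>i | f i \<noteq> 0. f i)"
        and g: "(\<forall>i. g i \<in> G i) \<and> finite {i. g i \<noteq> 0} \<and> v = (\<Sum>i | g i \<noteq> 0. g i)"
      show "f = g"
      proof (rule uniq)
        show "(\<Sum>i | f i \<noteq> 0. f i) = (\<Sum>i | g i \<noteq> 0. g i)" using f g by metis
      qed (use f g in auto)
    qed
  qed
qed

section \<open>From triangular bases and maximal chains to \<open>S = UNIV\<close>\<close>

text \<open>Only the strict part of \<open>r\<close> is asked to be well-founded, so the lemma
  serves both well-ordered bases and partially ordered ones with finite initial segments.\<close>

lemma S_of_triangular:
  assumes B: "is_basis scale B" and tri: "triangular_wrt scale B r T" and wf: "wf (r - Id)"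
  shows "S = UNIV"
proof -
  have "v \<in> B \<longrightarrow> v \<in> S" for v
    using wf
  proof (induction v rule: wf_induct_rule)
    case (less v)
    show ?case
    proof
      assume v: "v \<in> B"
      have "T v \<in> span {u \<in> B. (u, v) \<in> r}" using tri v by (auto simp: triangular_wrt_def)
      also have "\<dots> \<subseteq> span (insert v {u \<in> B. (u, v) \<in> r - Id})" by (rule span_mono) auto
      \<comment> \<open>Here \<open>a\<close> is the coefficient of \<open>v\<close> in
        \<open>T v\<close>. What remains involves strictly smaller basis vectors, which lie in
        \<open>S\<close> by induction.\<close>
      finally obtain a where "shift a v \<in> span {u \<in> B. (u, v) \<in> r - Id}"
        by (auto simp: span_breakdown_eq shift_def)
      moreover have "span {u \<in> B. (u, v) \<in> r - Id} \<subseteq> S"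
        using less by (intro span_minimal subspace_S) blast
      ultimately show "v \<in> S" using S_shift by blast
    qed
  qed
  then have "span B \<subseteq> S" by (intro span_minimal subspace_S) auto
  then show ?thesis using B by (auto simp: is_basis_def)
qed

text \<open>By maximality, each member \<open>W\<close> exceeds the span \<open>U\<close> of the
  members strictly below it by at most one dimension. Invariance then makes \<open>T\<close> act on
  \<open>W\<close> modulo \<open>U\<close> as a scalar, and \<open>S_shift\<close> carries
  membership in \<open>S\<close> from \<open>U\<close> to \<open>W\<close>.\<close>

lemma S_of_maximal_chain:
  assumes inv: "\<forall>W\<in>C. invariant_subspace scale T W" and wo: "well_ordered_by_inclusion C"
    and max: "\<not> (\<exists>D. (\<forall>W\<in>D. subspace W) \<and> well_ordered_by_inclusion D \<and> C \<subset> D)"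
  shows "S = UNIV"
proof -
  have wf: "wf {(A, B). A \<in> C \<and> B \<in> C \<and> A \<subset> B}" and chain: "\<forall>A\<in>C. \<forall>B\<in>C. A \<subseteq> B \<or> B \<subseteq> A"
    using wo by (auto simp: well_ordered_by_inclusion_iff)
  have mem: "U \<in> C" if "subspace U" "\<And>A. A \<in> C \<Longrightarrow> A \<subseteq> U \<or> U \<subseteq> A" for U
  proof (rule ccontr)
    assume "U \<notin> C"
    then have "C \<subset> insert U C" by auto
    moreover have "\<forall>W\<in>insert U C. subspace W"
      using inv that(1) by (auto simp: invariant_subspace_def)
    ultimately show False using max well_ordered_by_inclusion_insert[OF wo that(2)] by blast
  qed
  have "W \<in> C \<longrightarrow> W \<subseteq> S" for W
    using wf
  proof (induction W rule: wf_induct_rule)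
    case (less W)
    show ?case
    proof (intro impI subsetI)
      fix v assume W: "W \<in> C" and v: "v \<in> W"
      have sW: "subspace W" "T ` W \<subseteq> W" using inv W by (auto simp: invariant_subspace_def)
      define U where "U = span (\<Union>{X \<in> C. X \<subset> W})"
      have US: "U \<subseteq> S" unfolding U_def
        using less.IH W by (intro span_minimal subspace_S) blast
      have UW: "U \<subseteq> W" unfolding U_def by (intro span_minimal sW) auto
      have below: "X \<subseteq> U" if "X \<in> C" "X \<subset> W" for X
        unfolding U_def using that by (intro order_trans[OF _ span_superset] Union_upper) auto
      show "v \<in> S"
      proof (cases "v \<in> U")
        case False
        define X where "X = span (insert v U)"
        have XW: "X \<subseteq> W" unfolding X_def using v UW sW by (intro span_minimal) auto
        have vX: "v \<in> X" "U \<subseteq> X" unfolding X_def by (auto intro: span_base)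
        have "X \<in> C"
        proof (rule mem)
          fix A assume A: "A \<in> C"
          \<comment> \<open>A member strictly below \<open>W\<close> lies in \<open>U\<close> and so
            in \<open>X\<close>; any other member contains \<open>W\<close> and so
            \<open>X\<close>.\<close>
          show "A \<subseteq> X \<or> X \<subseteq> A"
            using below[OF A] chain A W XW vX by blast
        qed (simp add: X_def)
        \<comment> \<open>A proper inclusion would make \<open>X\<close> one of the members below
          \<open>W\<close>, hence part of \<open>U\<close>, although \<open>v\<close> is not in
          \<open>U\<close>.\<close>
        then have "X = W" using below[of X] vX XW False by blast
        then have "T v \<in> span (insert v U)" using sW v by (auto simp: X_def)
        then obtain a where "shift a v \<in> span U" by (auto simp: span_breakdown_eq shift_def)
        then have "shift a v \<in> U" by (simp only: U_def span_span)
        then have "shift a v \<in> S" using US by blast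
        then show ?thesis by (rule S_shift)
      qed (use US in auto)
    qed
  qed
  moreover have "UNIV \<in> C" by (rule mem) auto
  ultimately show ?thesis by auto
qed

section \<open>The maximal chain given by a well-ordered triangular basis\<close>

text \<open>The chain consists of the spans of all initial segments of the basis, including the
  empty one and \<open>B\<close>. Consecutive spans differ by one basis vector, which leaves no room
  for a further subspace.\<close>

lemma maximal_chain_of_triangularizable:
  assumes "triangularizable scale T"
  shows "\<exists>C. (\<forall>W\<in>C. invariant_subspace scale T W) \<and> well_ordered_by_inclusion C \<and>
        \<not> (\<exists>D. (\<forall>W\<in>D. subspace W) \<and> well_ordered_by_inclusion D \<and> C \<subset> D)"
proof -
  obtain B r where B: "is_basis scale B" and r: "well_order_on B r"
    and tri: "triangular_wrt scale B r T"
    using assms by (auto simp: triangularizable_def)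
  have wf: "wf (r - Id)" and tot: "total_on B r" and refl: "refl_on B r" and tr: "trans r"
    and rB: "r \<subseteq> B \<times> B" and antisym: "antisym r"
    using r by (auto simp: order_on_defs)
  define down where "down I \<longleftrightarrow> I \<subseteq> B \<and> (\<forall>v\<in>I. \<forall>u. (u, v) \<in> r \<longrightarrow> u \<in> I)" for I
  define C where "C = span ` Collect down"
  have minB: "\<exists>v\<in>Q. \<forall>u. (u, v) \<in> r \<longrightarrow> u \<noteq> v \<longrightarrow> u \<notin> Q" if "Q \<noteq> {}" for Q
    using wf that unfolding wf_eq_minimal by (metis DiffI ex_in_conv pair_in_Id_conv)
  have inv: "invariant_subspace scale T W" if "W \<in> C" for W
  proof -
    obtain I where I: "down I" "W = span I" using \<open>W \<in> C\<close> by (auto simp: C_def)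
    have "T v \<in> span I" if "v \<in> I" for v
    proof -
      have "T v \<in> span {u \<in> B. (u, v) \<in> r}"
        using tri that I(1) by (auto simp: triangular_wrt_def down_def)
      also have "\<dots> \<subseteq> span I" using that I(1) by (intro span_mono) (auto simp: down_def)
      finally show ?thesis .
    qed
    then have "T ` span I \<subseteq> span I"
      by (metis T.span_image image_subsetI span_minimal subspace_span)
    then show ?thesis using I by (simp add: invariant_subspace_def)
  qed
  have down_chain: "I \<subseteq> J \<or> J \<subseteq> I" if "down I" "down J" for I J
  proof (rule ccontr)
    assume "\<not> ?thesis"
    then obtain x y where "x \<in> I" "x \<notin> J" "y \<in> J" "y \<notin> I" by blast
    moreover from this have "(x, y) \<in> r \<or> (y, x) \<in> r"
      using that tot unfolding down_def total_on_def by (metis subsetD)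
    ultimately show False using that unfolding down_def by blast
  qed
  have wo: "well_ordered_by_inclusion C"
    unfolding well_ordered_by_inclusion_iff
  proof (intro conjI ballI)
    fix W X assume "W \<in> C" "X \<in> C"
    then obtain I J where "down I" "W = span I" "down J" "X = span J" by (auto simp: C_def)
    then show "W \<subseteq> X \<or> X \<subseteq> W"
      using down_chain[of I J] span_mono[of I J] span_mono[of J I] by blast
  next
    show "wf {(A, B). A \<in> C \<and> B \<in> C \<and> A \<subset> B}"
      unfolding wf_eq_minimal
    proof (intro allI impI)
      fix Q :: "'v set set" and W assume W: "W \<in> Q"
      show "\<exists>z\<in>Q. \<forall>y. (y, z) \<in> {(A, B). A \<in> C \<and> B \<in> C \<and> A \<subset> B} \<longrightarrow> y \<notin> Q"
      \<comment> \<open>The least member of \<open>Q \<inter> C\<close> is found through the least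
        basis vector \<open>v\<close> missed by some member. If nothing is missed, every member is
        the whole space. Otherwise a member \<open>X\<close> missing \<open>v\<close> is spanned by
        vectors below \<open>v\<close>, and by leastness these lie in all members.\<close>
      proof (cases "{v \<in> B. \<exists>X\<in>Q \<inter> C. v \<notin> X} = {}")
        case True
        have top: "X = UNIV" if "X \<in> Q \<inter> C" for X
        proof -
          have "subspace X" using inv that by (auto simp: invariant_subspace_def)
          then have "span B \<subseteq> X" using True that by (intro span_minimal) auto
          then show ?thesis using B by (auto simp: is_basis_def)
        qed
        show ?thesis using W top by (intro bexI[of _ W]) blast+
      next
        case False
        then obtain v where v: "v \<in> {v \<in> B. \<exists>X\<in>Q \<inter> C. v \<notin> X}"
          and least: "\<forall>u. (u, v) \<in> r \<longrightarrow> u \<noteq> v \<longrightarrow> u \<notin> {v \<in> B. \<exists>X\<in>Q \<inter> C. v \<notin> X}"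
          using minB[of "{v \<in> B. \<exists>X\<in>Q \<inter> C. v \<notin> X}"] by blast
        then obtain X where X: "X \<in> Q" "X \<in> C" "v \<notin> X" by blast
        then obtain I where I: "down I" "X = span I" by (auto simp: C_def)
        have "v \<notin> I" using X I span_base by blast
        have "(u, v) \<in> r \<and> u \<noteq> v" if "u \<in> I" for u
        proof -
          have "u \<noteq> v" "u \<in> B" "v \<in> B" "(v, u) \<notin> r"
            using that I(1) v \<open>v \<notin> I\<close> unfolding down_def by auto
          then show ?thesis using tot unfolding total_on_def by blast
        qed
        then have "I \<subseteq> Y" if "Y \<in> Q" "Y \<in> C" for Y
          using least that rB by blast
        then have "X \<subseteq> Y" if "Y \<in> Q" "Y \<in> C" for Y
          using that inv unfolding I(2) invariant_subspace_def by (metis span_minimal)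
        then show ?thesis using X by (intro bexI[of _ X]) blast+
      qed
    qed
  qed
  have "W \<in> C" if D: "\<forall>W\<in>D. subspace W" "well_ordered_by_inclusion D" "C \<subset> D" "W \<in> D" for W D
  proof -
    have W: "subspace W" using D by blast
    \<comment> \<open>This is the largest initial segment contained in \<open>W\<close>.\<close>
    define I where "I = {v \<in> B. \<forall>u. (u, v) \<in> r \<longrightarrow> u \<in> W}"
    have IW: "span I \<subseteq> W"
      using refl by (intro span_minimal W) (auto simp: I_def refl_on_def)
    have I: "down I"
      unfolding down_def I_def using rB tr by (blast dest: transD)
    have "W = span I"
    proof (cases "I = B")
      case True
      then show ?thesis using IW B by (auto simp: is_basis_def)
    next
      case False
      \<comment> \<open>Adding the least vector outside \<open>I\<close> gives the next initial
        segment. As \<open>v\<close> turns out not to be in \<open>W\<close>, comparability in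
        \<open>D\<close> squeezes \<open>W\<close> between \<open>span I\<close> and
        \<open>span (insert v I)\<close>.\<close>
      then obtain v where v: "v \<in> B - I" and least: "\<forall>u. (u, v) \<in> r \<longrightarrow> u \<noteq> v \<longrightarrow> u \<notin> B - I"
        using minB[of "B - I"] I by (auto simp: down_def)
      have low: "u \<in> I" if "(u, v) \<in> r" "u \<noteq> v" for u using least that rB by blast
      have "down (insert v I)"
        using I low v unfolding down_def by blast
      then have "span (insert v I) \<in> D" using D by (auto simp: C_def)
      then have cmp: "span (insert v I) \<subseteq> W \<or> W \<subseteq> span (insert v I)"
        using D by (auto simp: well_ordered_by_inclusion_iff)
      have "v \<notin> W"
      proof
        assume "v \<in> W"
        moreover have "u \<in> W" if "(u, v) \<in> r" "u \<noteq> v" for u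
          using low[OF that] IW span_base by blast
        ultimately have "v \<in> I" using v unfolding I_def by blast
        then show False using v by blast
      qed
      then have WI: "W \<subseteq> span (insert v I)" using cmp span_base by blast
      have "w \<in> span I" if w: "w \<in> W" for w
      proof -
        have "w \<in> span (insert v I)" using WI w by blast
        then obtain k where k: "w - k *s v \<in> span I" unfolding span_breakdown_eq by blast
        then have "w - (w - k *s v) \<in> W" using IW w W by (metis subsetD subspace_diff)
        then have kv: "k *s v \<in> W" by simp
        \<comment> \<open>A nonzero coefficient of \<open>v\<close> would put \<open>v\<close> into
          \<open>W\<close>.\<close>
        have "k = 0"
        proof (rule ccontr)
          assume "k \<noteq> 0"
          then have "v = (1 / k) *s (k *s v)" by simp
          then show False using kv subspace_scale[OF W kv, of "1 / k"] \<open>v \<notin> W\<close> by simp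
        qed
        then show ?thesis using k by simp
      qed
      then show ?thesis using IW by blast
    qed
    then show ?thesis using I by (auto simp: C_def)
  qed
  then show ?thesis using inv wo by (intro exI[of _ C]) blast
qed

section \<open>Triangular bases built from the filtration by kernels of powers\<close>

text \<open>Independent sets \<open>b n\<close> spanning \<open>E n\<close> are extended step by
  step, and \<open>h v\<close> is the first stage at which \<open>v\<close> occurs. Suitable shifts
  map a vector of stage \<open>n + 1\<close> into \<open>E n\<close>, hence into the span of vectors
  of lower height.\<close>

lemma basis_with_height:
  assumes S: "S = UNIV"
  obtains B and h :: "'v \<Rightarrow> nat" where "is_basis scale B"
    "\<And>v. v \<in> B \<Longrightarrow> \<exists>a. shift a v \<in> span {u \<in> B. h u < h v}"
proof -
  \<comment> \<open>A union over all \<open>a\<close>, in general not a subspace; the generators of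
    each stage are thereby killed by a power of a single shift.\<close>
  define E where "E n = (\<Union>a. {v. (shift a ^^ n) v = 0})" for n
  have E_Suc: "E n \<subseteq> E (Suc n)" for n by (auto simp: E_def)
  have "\<exists>b. \<forall>n. (b n \<subseteq> E n \<and> independent (b n) \<and> E n \<subseteq> span (b n)) \<and> b n \<subseteq> b (Suc n)"
  proof (rule dependent_nat_choice)
    have "E 0 \<subseteq> {0}" by (auto simp: E_def)
    then show "\<exists>x. x \<subseteq> E 0 \<and> independent x \<and> E 0 \<subseteq> span x"
      by (intro exI[of _ "{}"]) (auto simp: independent_empty)
  next
    fix x n assume "x \<subseteq> E n \<and> independent x \<and> E n \<subseteq> span x"
    then show "\<exists>y. (y \<subseteq> E (Suc n) \<and> independent y \<and> E (Suc n) \<subseteq> span y) \<and> x \<subseteq> y"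
      using E_Suc[of n] by (metis maximal_independent_subset_extend order_trans)
  qed
  then obtain b where b: "\<And>n. b n \<subseteq> E n" "\<And>n. independent (b n)" "\<And>n. E n \<subseteq> span (b n)"
    "\<And>n. b n \<subseteq> b (Suc n)" by blast
  have mono: "b m \<subseteq> b n" if "m \<le> n" for m n
    using b(4) that by (rule lift_Suc_mono_le)
  have mono_linear: "b m \<subseteq> b n \<or> b n \<subseteq> b m" for m n
    using mono nat_le_linear by blast
  define B where "B = (\<Union>n. b n)"
  define h where "h v = (LEAST n. v \<in> b n)" for v
  have h_mem: "v \<in> b (h v)" if "v \<in> B" for v
    unfolding h_def using that by (auto simp: B_def intro: LeastI)
  have h_le: "h v \<le> n" if "v \<in> b n" for v n
    unfolding h_def using that by (rule Least_le)
  show thesis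
  proof
    have "independent B"
      unfolding B_def using b(2) mono_linear
      by (intro independent_Union_directed) blast+
    moreover have "G a \<subseteq> span B" for a
    proof
      fix v assume "v \<in> G a"
      then obtain n where "v \<in> E n" by (auto simp: G_iff E_def)
      then have "v \<in> span (b n)" using b(3) by blast
      then show "v \<in> span B" using span_mono[of "b n" B] by (auto simp: B_def)
    qed
    then have "S \<subseteq> span B" unfolding S_def by (intro span_minimal) auto
    ultimately show "is_basis scale B" using S by (auto simp: is_basis_def)
    fix v assume v: "v \<in> B"
    show "\<exists>a. shift a v \<in> span {u \<in> B. h u < h v}"
    proof (cases "h v")
      case 0
      \<comment> \<open>Stage \<open>0\<close> only contains the zero vector, for which any
        \<open>a\<close> works.\<close>
      then have "v = 0" using h_mem[OF v] b(1)[of 0] by (auto simp: E_def)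
      then show ?thesis by (auto intro: span_zero)
    next
      case (Suc n)
      then obtain a where "(shift a ^^ Suc n) v = 0"
        using h_mem[OF v] b(1)[of "Suc n"] by (auto simp: E_def)
      then have "shift a v \<in> E n" by (auto simp: E_def funpow_swap1)
      then have "shift a v \<in> span (b n)" using b(3) by blast
      also have "\<dots> \<subseteq> span {u \<in> B. h u < h v}"
        using h_le Suc by (intro span_mono) (auto simp: B_def less_Suc_eq_le)
      finally show ?thesis by blast
    qed
  qed
qed

lemma triangularizable_of_S:
  assumes "S = UNIV"
  shows "triangularizable scale T"
proof -
  obtain B and h :: "'v \<Rightarrow> nat" where B: "is_basis scale B"
    and h: "\<And>v. v \<in> B \<Longrightarrow> \<exists>a. shift a v \<in> span {u \<in> B. h u < h v}"
    using basis_with_height[OF assms] by blast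
  obtain q where q: "well_order_on B q" using well_order_on by blast
  \<comment> \<open>Height comes first, and an arbitrary well-order of \<open>B\<close> breaks ties.
    Thus everything of smaller height precedes \<open>v\<close>.\<close>
  define r where "r = {(u, v). u \<in> B \<and> v \<in> B \<and> (h u < h v \<or> h u = h v \<and> (u, v) \<in> q)}"
  have "wf (inv_image (less_than <*lex*> (q - Id)) (\<lambda>v. (h v, v)))"
    using q by (auto simp: order_on_defs)
  then have "wf (r - Id)"
    by (rule wf_subset) (auto simp: r_def)
  moreover have "linear_order_on B r"
  proof -
    have q': "refl_on B q" "trans q" "antisym q" "total_on B q"
      using q by (auto simp: order_on_defs)
    have "trans r"
      using q'(2) unfolding r_def trans_def by (auto intro: less_trans)
    moreover have "antisym r"
      using q'(3) unfolding r_def antisym_def by auto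
    moreover have "total_on B r"
      using q'(4) unfolding r_def total_on_def by auto
    ultimately show ?thesis
      using q'(1) unfolding order_on_defs by (auto simp: r_def refl_on_def)
  qed
  ultimately have wo: "well_order_on B r" by (simp add: well_order_on_def)
  have "T v \<in> span {u \<in> B. (u, v) \<in> r}" if v: "v \<in> B" for v
  proof -
    obtain a where a: "shift a v \<in> span {u \<in> B. h u < h v}" using h v by blast
    have "span {u \<in> B. h u < h v} \<subseteq> span {u \<in> B. (u, v) \<in> r}"
      using v by (intro span_mono) (auto simp: r_def)
    moreover have "(v, v) \<in> r" using wo v by (auto simp: order_on_defs refl_on_def)
    ultimately show ?thesis
      unfolding T_eq_shift[of v a] using a v by (intro span_add span_scale) (auto intro: span_base)
  qed
  then show ?thesis using B wo unfolding triangularizable_def triangular_wrt_def by blast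
qed

text \<open>Instead of all vectors of smaller height, only a finite set \<open>A v\<close> that is
  needed to express \<open>shift (a v) v\<close> is placed below \<open>v\<close>, and the order is
  generated by these relations. Finite branching with decreasing height keeps initial segments
  finite.\<close>

lemma finite_triangular_of_S:
  assumes "S = UNIV"
  shows "\<exists>B r. is_basis scale B \<and> partial_order_on B r \<and> triangular_wrt scale B r T \<and>
        (\<forall>v\<in>B. finite {u \<in> B. (u, v) \<in> r})"
proof -
  obtain B and h :: "'v \<Rightarrow> nat" where B: "is_basis scale B"
    and h: "\<And>v. v \<in> B \<Longrightarrow> \<exists>a. shift a v \<in> span {u \<in> B. h u < h v}"
    using basis_with_height[OF assms] by blast
  then obtain a where a: "\<And>v. v \<in> B \<Longrightarrow> shift (a v) v \<in> span {u \<in> B. h u < h v}"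
    by metis
  have "\<exists>A. finite A \<and> A \<subseteq> {u \<in> B. h u < h v} \<and> shift (a v) v \<in> span A" if v: "v \<in> B" for v
  proof -
    obtain A c where "finite A" "A \<subseteq> {u \<in> B. h u < h v}" "shift (a v) v = (\<Sum>u\<in>A. c u *s u)"
      using a[OF v] unfolding span_explicit by blast
    moreover from this have "shift (a v) v \<in> span A" by (auto intro: span_sum span_scale span_base)
    ultimately show ?thesis by blast
  qed
  then obtain A where A: "\<And>v. v \<in> B \<Longrightarrow> finite (A v)" "\<And>v. v \<in> B \<Longrightarrow> A v \<subseteq> {u \<in> B. h u < h v}"
    "\<And>v. v \<in> B \<Longrightarrow> shift (a v) v \<in> span (A v)" by metis
  define e where "e = {(u, v). v \<in> B \<and> u \<in> A v}"
  define r where "r = Restr (e\<^sup>*) B"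
  \<comment> \<open>Strict increase of the height along edges gives antisymmetry of
    \<open>r\<close>.\<close>
  have e_height: "u = v \<or> h u < h v" if "(u, v) \<in> e\<^sup>*" for u v
    using that by (induction rule: rtrancl_induct) (use A(2) in \<open>force simp: e_def\<close>)+
  have fin: "v \<in> B \<Longrightarrow> finite {u. (u, v) \<in> e\<^sup>*}" for v
  proof (induction "h v" arbitrary: v rule: less_induct)
    case less
    \<comment> \<open>The last edge of a nontrivial path to \<open>v\<close> starts in
      \<open>A v\<close>, where the heights are smaller.\<close>
    have "{u. (u, v) \<in> e\<^sup>*} \<subseteq> insert v (\<Union>w\<in>A v. {u. (u, w) \<in> e\<^sup>*})"
      by (auto elim: rtranclE simp: e_def)
    moreover have "finite (insert v (\<Union>w\<in>A v. {u. (u, w) \<in> e\<^sup>*}))"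
      using less A(1,2)[OF less.prems] by auto
    ultimately show ?case by (rule finite_subset)
  qed
  have po: "partial_order_on B r"
    unfolding order_on_defs
  proof (intro conjI)
    show "trans r" by (auto simp: r_def trans_def)
    show "antisym r" unfolding r_def antisym_def using e_height by (metis IntD1 less_asym)
  qed (auto simp: r_def refl_on_def)
  have "T v \<in> span {u \<in> B. (u, v) \<in> r}" if v: "v \<in> B" for v
  proof -
    have "A v \<subseteq> {u \<in> B. (u, v) \<in> r}"
      using A(2)[OF v] v by (auto simp: r_def e_def)
    then have "shift (a v) v \<in> span {u \<in> B. (u, v) \<in> r}"
      using A(3)[OF v] span_mono by blast
    moreover have "v \<in> span {u \<in> B. (u, v) \<in> r}"
      using v by (intro span_base) (auto simp: r_def)
    ultimately show ?thesis
      unfolding T_eq_shift[of v "a v"] by (intro span_add span_scale)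
  qed
  moreover have "finite {u \<in> B. (u, v) \<in> r}" if "v \<in> B" for v
    using fin[OF that] by (rule rev_finite_subset) (auto simp: r_def)
  ultimately show ?thesis using B po unfolding triangular_wrt_def by blast
qed

section \<open>Annihilating polynomials\<close>

lemma act_mult: "poly_act scale T (p * q) v = poly_act scale T p (poly_act scale T q v)"
  by (simp add: PM.scale_scale)

lemma act_linear_factor: "poly_act scale T [:- a, 1:] v = shift a v"
  by (simp add: act_pCons act_0 T.zero shift_def)

text \<open>The linear factors are stripped one at a time, each by one use of
  \<open>S_shift\<close>.\<close>

lemma S_of_split_polynomial:
  assumes "splits_into_linear_factors p" "poly_act scale T p v = 0"
  shows "v \<in> S"
proof -
  obtain qs where qs: "\<forall>q\<in>set qs. degree q = 1" "p = prod_list qs"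
    using assms by (auto simp: splits_into_linear_factors_def)
  have "poly_act scale T (prod_list qs) v \<in> S \<Longrightarrow> v \<in> S" using qs(1)
  proof (induction qs)
    case (Cons q qs)
    have "degree q = 1" using Cons.prems by simp
    then obtain c d where q: "q = [:c, d:]" "d \<noteq> 0"
      by (cases q) (auto split: if_splits elim: degree_eq_zeroE)
    let ?w = "poly_act scale T (prod_list qs) v"
    \<comment> \<open>The factors need not be monic: \<open>c + d x\<close> acts as \<open>d\<close>
      times the shift by its root \<open>- c / d\<close>.\<close>
    have "poly_act scale T q w = d *s shift (- c / d) w" for w
      using q by (simp add: scale_right_distrib act_pCons act_0 T.zero shift_def T.add T.scale scale_right_diff_distrib add.commute)
    then have "d *s shift (- c / d) ?w \<in> S"
      using Cons.prems by (simp add: act_mult del: PM.scale_scale)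
    then have "(1 / d) *s (d *s shift (- c / d) ?w) \<in> S" by (rule subspace_scale[OF subspace_S])
    then have "?w \<in> S" using q by (auto intro: S_shift)
    then show ?case using Cons by simp
  qed simp
  then show ?thesis using assms(2) qs subspace_0[OF subspace_S] by simp
qed

text \<open>Algebraic closedness supplies a root of any nonconstant \<open>p\<close>. Splitting it
  off shows that the cofactor kills \<open>shift a v\<close>, so induction and
  \<open>S_shift\<close> apply; a nonzero constant only kills zero.\<close>

lemma S_of_polynomial:
  assumes closed: "\<And>p::'k poly. degree p > 0 \<Longrightarrow> \<exists>a. poly p a = 0"
    and "p \<noteq> 0" "poly_act scale T p v = 0"
  shows "v \<in> S"
  using assms(2,3)
proof (induction "degree p" arbitrary: p v rule: less_induct)
  case less
  show ?case
  proof (cases "degree p = 0")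
    case True
    then obtain c where "p = [:c:]" by (rule degree_eq_zeroE)
    then show ?thesis using less.prems by (auto simp: act_const subspace_0[OF subspace_S])
  next
    case False
    then obtain a where "poly p a = 0" using closed by blast
    then obtain q where q: "p = q * [:- a, 1:]" by (metis dvdE mult.commute poly_eq_0_iff_dvd)
    then have q0: "q \<noteq> 0" using less.prems by auto
    then have "degree q < degree p" unfolding q by (subst degree_mult_eq) auto
    moreover have "poly_act scale T q (shift a v) = 0"
      using less.prems by (simp add: q act_mult act_linear_factor del: mult_pCons_right)
    ultimately show ?thesis using less.hyps q0 S_shift by blast
  qed
qed

text \<open>Scalars act as constant polynomials, so closure under them is commutativity of
  \<open>k[x]\<close>.\<close>

lemma subspace_act_kernel: "subspace {v. poly_act scale T p v = 0}"
proof (rule subspaceI)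
  fix c v assume "v \<in> {v. poly_act scale T p v = 0}"
  then have "poly_act scale T ([:c:] * p) v = 0" by (simp only: act_mult act_const) simp
  then have "poly_act scale T (p * [:c:]) v = 0" by (simp only: mult.commute)
  then show "c *s v \<in> {v. poly_act scale T p v = 0}" by (simp only: act_mult act_const) simp
qed (auto simp: PM.scale_right_distrib)

lemma act_mult_eq_0:
  assumes "poly_act scale T p v = 0 \<or> poly_act scale T q v = 0"
  shows "poly_act scale T (p * q) v = 0"
  using assms by (metis act_mult mult.commute PM.scale_zero_right)

lemma splits_mult:
  fixes p q :: "'k poly"
  assumes "splits_into_linear_factors p" "splits_into_linear_factors q"
  shows "splits_into_linear_factors (p * q)"
proof -
  obtain ps qs where "\<forall>x\<in>set ps. degree x = 1" "p = prod_list ps"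
    "\<forall>x\<in>set qs. degree x = 1" "q = prod_list qs"
    using assms by (auto simp: splits_into_linear_factors_def)
  then show ?thesis unfolding splits_into_linear_factors_def
    by (intro exI[of _ "ps @ qs"]) auto
qed

lemma splits_linear: "degree p = 1 \<Longrightarrow> splits_into_linear_factors p"
  unfolding splits_into_linear_factors_def by (intro exI[of _ "[p]"]) auto

lemma splits_1: "splits_into_linear_factors 1"
  unfolding splits_into_linear_factors_def by (intro exI[of _ "[]"]) auto

lemma splits_nonzero: "splits_into_linear_factors p \<Longrightarrow> p \<noteq> 0"
  unfolding splits_into_linear_factors_def by (force simp: prod_list_zero_iff)

text \<open>A power of \<open>x - a\<close> kills an element of \<open>G a\<close>, and a product of
  annihilators kills a sum. The result may be the constant \<open>1\<close>, as an empty
  product.\<close>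

lemma annihilator_of_S:
  assumes "S = UNIV"
  shows "\<exists>p. splits_into_linear_factors p \<and> poly_act scale T p v = 0"
proof -
  have "v \<in> span (\<Union>a. G a)" using assms by (auto simp: S_def)
  then show ?thesis
  proof (induction v rule: span_induct_alt)
    case base
    show ?case by (intro exI[of _ 1]) (auto simp: splits_1)
  next
    case (step c x y)
    then obtain p where p: "splits_into_linear_factors p" "poly_act scale T p y = 0" by blast
    obtain a n where n: "(shift a ^^ n) x = 0" using step by (auto simp: G_iff)
    let ?q = "[:- a, 1:] ^ n"
    have "splits_into_linear_factors [:- a, 1:]" by (rule splits_linear) simp
    then have q: "splits_into_linear_factors ?q"
      by (induction n) (auto simp: splits_1 intro: splits_mult simp del: mult_pCons_left)
    have "poly_act scale T ([:- a, 1:] ^ m) x = (shift a ^^ m) x" for m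
      by (induction m) (auto simp: act_mult act_linear_factor simp del: mult_pCons_left)
    then have "poly_act scale T ?q x = 0" using n by simp
    then have "x \<in> {v. poly_act scale T (p * ?q) v = 0}" "y \<in> {v. poly_act scale T (p * ?q) v = 0}"
      using p by (auto intro: act_mult_eq_0)
    then have "c *s x + y \<in> {v. poly_act scale T (p * ?q) v = 0}"
      by (intro subspace_add subspace_scale subspace_act_kernel)
    then show ?case using splits_mult[OF p(1) q] by blast
  qed
qed

lemma annihilator_iff:
  "S = UNIV \<longleftrightarrow> (\<forall>W. finite_dim_subspace scale W \<longrightarrow>
      (\<exists>p. degree p > 0 \<and> splits_into_linear_factors p \<and> (\<forall>w\<in>W. poly_act scale T p w = 0)))"
proof (intro iffI allI impI)
  fix W assume S: "S = UNIV" and W: "finite_dim_subspace scale W"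
  obtain B where B: "finite B" "span B = W" using W by (auto simp: finite_dim_subspace_def)
  have "\<exists>p. splits_into_linear_factors p \<and> (\<forall>v\<in>B. poly_act scale T p v = 0)"
    using B(1)
  proof (induction B)
    case empty
    show ?case using splits_1 by blast
  next
    case (insert v B)
    then obtain p q where "splits_into_linear_factors p" "\<forall>v\<in>B. poly_act scale T p v = 0"
      "splits_into_linear_factors q" "poly_act scale T q v = 0"
      using annihilator_of_S[OF S, of v] by blast
    then show ?case
      by (intro exI[of _ "p * q"]) (auto intro: splits_mult act_mult_eq_0)
  qed
  then obtain p where p: "splits_into_linear_factors p" "\<forall>v\<in>B. poly_act scale T p v = 0" by blast
  have "span B \<subseteq> {v. poly_act scale T p v = 0}"
    using p by (intro span_minimal subspace_act_kernel) auto
  \<comment> \<open>The extra factor \<open>x\<close> guarantees positive degree, since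
    \<open>p\<close> is possibly \<open>1\<close>, for example when \<open>B\<close> is
    empty.\<close>
  then have "\<forall>w\<in>W. poly_act scale T ([:0, 1:] * p) w = 0"
    using B by (auto intro!: act_mult_eq_0 simp del: mult_pCons_left)
  moreover have "degree ([:0, 1:] * p) > 0"
    using splits_nonzero[OF p(1)] by (subst degree_mult_eq) auto
  moreover have "splits_into_linear_factors ([:0, 1:] * p)"
    by (intro splits_mult splits_linear p) simp
  ultimately show "\<exists>p. degree p > 0 \<and> splits_into_linear_factors p \<and> (\<forall>w\<in>W. poly_act scale T p w = 0)"
    by blast
next
  assume *: "\<forall>W. finite_dim_subspace scale W \<longrightarrow>
      (\<exists>p. degree p > 0 \<and> splits_into_linear_factors p \<and> (\<forall>w\<in>W. poly_act scale T p w = 0))"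
  have "v \<in> S" for v
  proof -
    obtain B where "B \<subseteq> {v}" "independent B" "{v} \<subseteq> span B"
      using maximal_independent_subset by blast
    then have "finite_dim_subspace scale (span B)" "v \<in> span B"
      by (auto simp: finite_dim_subspace_def intro: finite_subset)
    then show ?thesis using * S_of_split_polynomial by blast
  qed
  then show "S = UNIV" by auto
qed

section \<open>Finite-dimensional invariant subspaces and local artinianity\<close>

text \<open>The iterates of \<open>shift a\<close> on an element of \<open>G a\<close> reach zero,
  so finitely many of them span an invariant subspace. Joining such sets handles linear
  combinations.\<close>

lemma finite_invariant_generators_of_S:
  assumes "S = UNIV"
  shows "\<exists>F. finite F \<and> T ` F \<subseteq> span F \<and> v \<in> span F"
proof -
  have "v \<in> span (\<Union>a. G a)" using assms by (auto simp: S_def)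
  then show ?thesis
  proof (induction v rule: span_induct_alt)
    case base
    show ?case by (intro exI[of _ "{}"]) (auto intro: span_zero)
  next
    case (step c x y)
    then obtain F where F: "finite F" "T ` F \<subseteq> span F" "y \<in> span F" by blast
    obtain a n where n: "(shift a ^^ n) x = 0" using step by (auto simp: G_iff)
    let ?H = "(\<lambda>i. (shift a ^^ i) x) ` {..n}"
    have "T ((shift a ^^ i) x) \<in> span ?H" if "i \<le> n" for i
    proof -
      have "(shift a ^^ Suc i) x \<in> span ?H"
      proof (cases "i = n")
        case True
        then show ?thesis using n by (simp add: span_zero)
      next
        case False
        then have "Suc i \<le> n" using that by simp
        then show ?thesis by (intro span_base) blast
      qed
      moreover have "(shift a ^^ i) x \<in> span ?H" using that by (intro span_base) blast
      ultimately show ?thesis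
        unfolding T_eq_shift[of "(shift a ^^ i) x" a] by (auto intro: span_add span_scale)
    qed
    then have "T ` (?H \<union> F) \<subseteq> span (?H \<union> F)"
      using F(2) span_mono[of ?H "?H \<union> F"] span_mono[of F "?H \<union> F"] by blast
    moreover have "x \<in> span (?H \<union> F)"
      by (intro span_base UnI1 image_eqI[of _ _ 0]) auto
    moreover have "y \<in> span (?H \<union> F)" using F(3) span_mono[of F "?H \<union> F"] by blast
    ultimately show ?case using F(1)
      by (intro exI[of _ "?H \<union> F"]) (auto intro!: span_add span_scale)
  qed
qed

lemma finite_dim_invariant_of_S:
  assumes S: "S = UNIV" and W: "finite_dim_subspace scale W"
  shows "\<exists>W'. finite_dim_subspace scale W' \<and> invariant_subspace scale T W' \<and> W \<subseteq> W'"
proof -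
  obtain B where B: "finite B" "span B = W" using W by (auto simp: finite_dim_subspace_def)
  obtain F where F: "\<And>v. finite (F v)" "\<And>v. T ` F v \<subseteq> span (F v)" "\<And>v. v \<in> span (F v)"
    using finite_invariant_generators_of_S[OF S] by metis
  let ?F = "\<Union>v\<in>B. F v"
  have up: "span (F v) \<subseteq> span ?F" if "v \<in> B" for v using that by (intro span_mono) auto
  have "T ` ?F \<subseteq> span ?F" using F(2) up by blast
  then have "T ` span ?F \<subseteq> span ?F"
    by (metis T.span_image span_minimal subspace_span)
  moreover have "W \<subseteq> span ?F"
    unfolding B(2)[symmetric] using F(3) up by (intro span_minimal) auto
  moreover have "finite_dim_subspace scale (span ?F)"
  proof -
    obtain A where A: "A \<subseteq> ?F" "independent A" "?F \<subseteq> span A"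
      using maximal_independent_subset by blast
    have "span A = span ?F"
      using A by (intro subset_antisym span_mono span_minimal) auto
    moreover have "finite A" using A(1) B(1) F(1) by (meson finite_UN finite_subset)
    ultimately show ?thesis using A(2) by (auto simp: finite_dim_subspace_def)
  qed
  ultimately show ?thesis by (auto simp: invariant_subspace_def)
qed

lemma act_subspaceD: "PM.subspace N \<Longrightarrow> subspace N"
  by (rule subspaceI) (auto simp: PM.subspace_0 PM.subspace_add PM.subspace_scale simp flip: act_const)

lemma act_subspace_of_invariant:
  assumes "invariant_subspace scale T W"
  shows "PM.subspace W"
proof (rule PM.subspaceI)
  have W: "subspace W" "T ` W \<subseteq> W" using assms by (auto simp: invariant_subspace_def)
  show "0 \<in> W" by (rule subspace_0[OF W(1)])
  show "u + v \<in> W" if "u \<in> W" "v \<in> W" for u v using that by (rule subspace_add[OF W(1)])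
  show "poly_act scale T p v \<in> W" if v: "v \<in> W" for p v
  proof -
    have "(T ^^ i) v \<in> W" for i using v W(2) by (induction i) auto
    then show ?thesis unfolding poly_act_def by (intro subspace_sum subspace_scale W(1))
  qed
qed

text \<open>A finitely generated submodule lies in a finite-dimensional invariant subspace, and its
  submodules are in particular \<open>k\<close>-subspaces, so the descending chain condition comes
  from dimension.\<close>

lemma locally_artinian_of_finite_dim_invariant:
  assumes *: "\<forall>W. finite_dim_subspace scale W \<longrightarrow>
          (\<exists>W'. finite_dim_subspace scale W' \<and> invariant_subspace scale T W' \<and> W \<subseteq> W')"
  shows "locally_artinian (poly_act scale T)"
  unfolding locally_artinian_def artinian_submodule_def
proof (intro allI impI conjI PM.subspace_span)
  fix A :: "'v set" and N :: "nat \<Rightarrow> 'v set"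
  assume A: "finite A" and N: "(\<forall>n. PM.subspace (N n) \<and> N n \<subseteq> PM.span A) \<and> decseq N"
  obtain B where B: "B \<subseteq> A" "independent B" "A \<subseteq> span B"
    using maximal_independent_subset by blast
  then have "finite_dim_subspace scale (span B)"
    using A by (auto simp: finite_dim_subspace_def intro: finite_subset)
  then obtain W where W: "finite_dim_subspace scale W" "invariant_subspace scale T W" "span B \<subseteq> W"
    using * by blast
  then obtain F where F: "finite F" "span F = W" by (auto simp: finite_dim_subspace_def)
  have "PM.span A \<subseteq> W"
    using B(3) W act_subspace_of_invariant by (intro PM.span_minimal) auto
  then show "\<exists>m. \<forall>n\<ge>m. N n = N m"
    using N F by (intro decreasing_subspaces_stabilize[of F]) (auto intro: act_subspaceD)
qed

text \<open>The cyclic submodules generated by \<open>x^n v\<close> decrease and so stabilize at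
  some \<open>m\<close>. Then \<open>x^m v = q x^(m+1) v\<close> for some \<open>q\<close>, and
  \<open>x^m - q x^(m+1)\<close> kills \<open>v\<close>.\<close>

lemma annihilator_of_locally_artinian:
  assumes "locally_artinian (poly_act scale T)"
  shows "\<exists>p. p \<noteq> 0 \<and> poly_act scale T p v = 0"
proof -
  let ?x = "\<lambda>n. poly_act scale T (monom 1 n) v"
  have art: "artinian_submodule (poly_act scale T) (PM.span {v})"
    using assms by (simp add: locally_artinian_def)
  let ?N = "\<lambda>n. PM.span {?x n}"
  have mult: "?x (Suc n) = poly_act scale T [:0, 1:] (?x n)" for n
    by (simp add: act_mult[symmetric] monom_Suc)
  have "?N (Suc n) \<subseteq> ?N n" for n
  proof (rule PM.span_minimal)
    show "{?x (Suc n)} \<subseteq> ?N n"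
      unfolding mult using PM.span_scale[OF PM.span_base] by blast
  qed (rule PM.subspace_span)
  then have "decseq ?N" by (rule decseq_SucI)
  moreover have "?N n \<subseteq> PM.span {v}" for n
    by (intro PM.span_minimal) (auto intro: PM.span_scale PM.span_base)
  ultimately obtain m where m: "\<forall>n\<ge>m. ?N n = ?N m"
    using art unfolding artinian_submodule_def
    by (metis (no_types, lifting) PM.subspace_span)
  then have "?x m \<in> ?N (Suc m)" using PM.span_base by (metis insertI1 le_Suc_eq le_refl)
  then obtain q where q: "?x m = poly_act scale T q (?x (Suc m))"
    by (auto simp: PM.span_singleton)
  then have "poly_act scale T (monom 1 m - q * monom 1 (Suc m)) v = 0"
    unfolding PM.scale_left_diff_distrib act_mult using q by (metis diff_self)
  \<comment> \<open>The product with \<open>q\<close> has no terms of degree below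
    \<open>m + 1\<close>, so the coefficient at \<open>m\<close> shows that the annihilator is
    nonzero.\<close>
  moreover have "coeff (monom 1 m - q * monom 1 (Suc m)) m = 1"
    by (simp add: mult.commute[of q] coeff_monom_mult)
  then have "monom 1 m - q * monom 1 (Suc m) \<noteq> 0" by (metis coeff_0 zero_neq_one)
  ultimately show ?thesis by blast
qed

end

section \<open>The equivalences, assembled through \<open>S = UNIV\<close>\<close>

theorem theorem8:
  fixes scale :: "'k::field \<Rightarrow> 'v::ab_group_add \<Rightarrow> 'v"
    and T :: "'v \<Rightarrow> 'v"
  assumes "vector_space scale"
    and "Vector_Spaces.linear scale scale T"
  shows "
    (triangularizable scale T \<longleftrightarrow>
      (\<forall>W. finite_dim_subspace scale W \<longrightarrow>
        (\<exists>p. degree p > 0 \<and> splits_into_linear_factors p \<and>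
          (\<forall>w\<in>W. poly_act scale T p w = 0)))) \<and>
    (triangularizable scale T \<longleftrightarrow>
      (\<exists>C. (\<forall>W\<in>C. invariant_subspace scale T W) \<and> well_ordered_by_inclusion C \<and>
        \<not> (\<exists>D. (\<forall>W\<in>D. module.subspace scale W) \<and> well_ordered_by_inclusion D \<and> C \<subset> D))) \<and>
    (triangularizable scale T \<longleftrightarrow>
      is_direct_sum scale (\<lambda>a::'k. generalized_eigenspace scale T a)) \<and>
    (triangularizable scale T \<longleftrightarrow>
      (\<exists>B r. is_basis scale B \<and> partial_order_on B r \<and> triangular_wrt scale B r T \<and>
        (\<forall>v\<in>B. finite {u \<in> B. (u, v) \<in> r}))) \<and>
    ((\<forall>p::'k poly. degree p > 0 \<longrightarrow> (\<exists>a. poly p a = 0)) \<longrightarrow>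
      (triangularizable scale T \<longleftrightarrow>
        (\<forall>W. finite_dim_subspace scale W \<longrightarrow>
          (\<exists>W'. finite_dim_subspace scale W' \<and> invariant_subspace scale T W' \<and> W \<subseteq> W'))) \<and>
      (triangularizable scale T \<longleftrightarrow> locally_artinian (poly_act scale T)))"
proof -
  interpret vector_space scale by fact
  interpret L: Vector_Spaces.linear scale scale T by fact
  interpret endomorphism scale T by unfold_locales
  have 1: "triangularizable scale T \<longleftrightarrow> S = UNIV"
    using triangularizable_of_S S_of_triangular
    by (auto simp: triangularizable_def well_order_on_def)
  have 3: "S = UNIV \<longleftrightarrow> (\<exists>C. (\<forall>W\<in>C. invariant_subspace scale T W) \<and> well_ordered_by_inclusion C \<and>
        \<not> (\<exists>D. (\<forall>W\<in>D. subspace W) \<and> well_ordered_by_inclusion D \<and> C \<subset> D))"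
  proof
    assume "S = UNIV"
    then show "\<exists>C. (\<forall>W\<in>C. invariant_subspace scale T W) \<and> well_ordered_by_inclusion C \<and>
        \<not> (\<exists>D. (\<forall>W\<in>D. subspace W) \<and> well_ordered_by_inclusion D \<and> C \<subset> D)"
      by (intro maximal_chain_of_triangularizable) (simp add: 1)
  qed (elim exE conjE, rule S_of_maximal_chain)
  have 5: "S = UNIV \<longleftrightarrow> (\<exists>B r. is_basis scale B \<and> partial_order_on B r \<and> triangular_wrt scale B r T \<and>
        (\<forall>v\<in>B. finite {u \<in> B. (u, v) \<in> r}))"
  proof
    assume "\<exists>B r. is_basis scale B \<and> partial_order_on B r \<and> triangular_wrt scale B r T \<and>
        (\<forall>v\<in>B. finite {u \<in> B. (u, v) \<in> r})"
    then show "S = UNIV"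
      by (elim exE conjE) (rule S_of_triangular, auto intro: wf_strict_part_of_finite_initial_segments)
  qed (rule finite_triangular_of_S)
  have 67: "(S = UNIV \<longleftrightarrow> (\<forall>W. finite_dim_subspace scale W \<longrightarrow>
          (\<exists>W'. finite_dim_subspace scale W' \<and> invariant_subspace scale T W' \<and> W \<subseteq> W'))) \<and>
      (S = UNIV \<longleftrightarrow> locally_artinian (poly_act scale T))"
    if closed: "\<forall>p::'k poly. degree p > 0 \<longrightarrow> (\<exists>a. poly p a = 0)"
  proof -
    \<comment> \<open>This closes the cycle from \<open>S = UNIV\<close> through invariant subspaces
      to local artinianity; algebraic closedness turns the annihilators into membership in
      \<open>S\<close>.\<close>
    have "S = UNIV" if "locally_artinian (poly_act scale T)"
      using annihilator_of_locally_artinian[OF that] S_of_polynomial closed by blast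
    then show ?thesis
      using finite_dim_invariant_of_S locally_artinian_of_finite_dim_invariant by blast
  qed
  show ?thesis
    unfolding 1
    by (intro conjI impI annihilator_iff 3 5 direct_sum_iff[symmetric]
        67[THEN conjunct1] 67[THEN conjunct2])
qed

end
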